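(* Let $V$ be a $2\pi$-periodic real valued potential, and let $H$ be the Schrödinger operator $H\psi=-\psi''+V\psi$ on $2\pi$-periodic functions, with ground state energy $E_0(H)$. Let $\phi$ be a twice differentiable $2\pi$-periodic function which is everywhere $>0$. Then the ground state energy of $H$ satisfies $$E_0(H)\ \ge\ E_\phi:=\min_\theta\left\{V(\theta)-\frac{\phi''(\theta)}{\phi(\theta)}\right\}.$$
   Context: $H$ acts in $L^2(\mathbb T,d\theta)$, $\mathbb T$ the circle of angles mod $2\pi$ (i.e. periodic boundary conditions on an interval of length $2\pi$). As implicit in speaking of its ground state energy, $V$ is assumed such that $H$ is a self-adjoint operator bounded below; $E_0(H)=\inf\{\langle\psi,H\psi\rangle:\ \psi\in\operatorname{dom}H,\ \|\psi\|=1\}$ is the bottom of its spectrum. The minimum defining $E_\phi$ is assumed to exist. *)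

theory Defs
  imports "HOL-Analysis.Analysis"
begin

definition periodic_2pi :: "(real \<Rightarrow> 'b) \<Rightarrow> bool" where
  "periodic_2pi f \<longleftrightarrow> (\<forall>x. f (x + 2 * pi) = f x)"

subsection \<open>The Hilbert space of square-integrable functions on the circle\<close>

text \<open>
  Elements are represented by \<open>2\<pi>\<close>-periodic functions; no quotient by almost-everywhere equality
  is taken.  Operators are represented by their graphs, which are closed under changing
  either component on a null set.
\<close>

definition L2_circle :: "(real \<Rightarrow> complex) set" where
  "L2_circle = {f. periodic_2pi f \<and> f \<in> borel_measurable lebesgue \<and>
     set_integrable lebesgue {0..2 * pi} (\<lambda>x. (cmod (f x))\<^sup>2)}"

definition L2_inner :: "(real \<Rightarrow> complex) \<Rightarrow> (real \<Rightarrow> complex) \<Rightarrow> complex" where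
  "L2_inner f g = set_lebesgue_integral lebesgue {0..2 * pi} (\<lambda>x. cnj (f x) * g x)"

definition L2_norm :: "(real \<Rightarrow> complex) \<Rightarrow> real" where
  "L2_norm f = sqrt (set_lebesgue_integral lebesgue {0..2 * pi} (\<lambda>x. (cmod (f x))\<^sup>2))"

type_synonym operator_graph = "((real \<Rightarrow> complex) \<times> (real \<Rightarrow> complex)) set"

definition densely_defined :: "operator_graph \<Rightarrow> bool" where
  "densely_defined G \<longleftrightarrow>
     (\<forall>f\<in>L2_circle. \<forall>\<epsilon>>0. \<exists>\<psi>\<in>Domain G. L2_norm (\<lambda>x. f x - \<psi> x) < \<epsilon>)"

definition adjoint_graph :: "operator_graph \<Rightarrow> operator_graph" where
  "adjoint_graph G = {(\<xi>, \<zeta>). \<xi> \<in> L2_circle \<and> \<zeta> \<in> L2_circle \<and>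
     (\<forall>(\<psi>, \<eta>)\<in>G. L2_inner \<xi> \<eta> = L2_inner \<zeta> \<psi>)}"

definition self_adjoint :: "operator_graph \<Rightarrow> bool" where
  "self_adjoint G \<longleftrightarrow> densely_defined G \<and> adjoint_graph G = G"

definition bounded_below :: "operator_graph \<Rightarrow> bool" where
  "bounded_below G \<longleftrightarrow>
     (\<exists>c. \<forall>(\<psi>, \<eta>)\<in>G. Re (L2_inner \<psi> \<eta>) \<ge> c * (L2_norm \<psi>)\<^sup>2)"

text \<open>For a self-adjoint operator \<open>\<langle>\<psi>, H\<psi>\<rangle>\<close> is real, so taking real parts loses nothing.\<close>

definition ground_state_energy :: "operator_graph \<Rightarrow> real" where
  "ground_state_energy G = Inf {Re (L2_inner \<psi> \<eta>) |\<psi> \<eta>. (\<psi>, \<eta>) \<in> G \<and> L2_norm \<psi> = 1}"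

subsection \<open>The Schroedinger operator\<close>

text \<open>
  \<open>u\<close> is differentiable everywhere with derivative \<open>u'\<close>, and \<open>u'\<close> is locally absolutely continuous
  with almost-everywhere derivative \<open>u''\<close>, i.e. \<open>u'\<close> is an indefinite Lebesgue integral of \<open>u''\<close>.
\<close>

definition has_ac_derivatives ::
    "(real \<Rightarrow> complex) \<Rightarrow> (real \<Rightarrow> complex) \<Rightarrow> (real \<Rightarrow> complex) \<Rightarrow> bool" where
  "has_ac_derivatives u u' u'' \<longleftrightarrow>
     (\<forall>x. (u has_vector_derivative u' x) (at x)) \<and>
     (\<forall>a b. a \<le> b \<longrightarrow> set_integrable lebesgue {a..b} u'' \<and>
        set_lebesgue_integral lebesgue {a..b} u'' = u' b - u' a)"

text \<open>
  The graph of \<open>\<psi> \<mapsto> -\<psi>'' + V \<psi>\<close> with maximal domain: all (classes of) periodic \<open>u\<close> with \<open>u'\<close>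
  locally absolutely continuous such that \<open>-u'' + V u\<close> is square-integrable.  Periodicity of \<open>u\<close>
  on the whole line entails that of \<open>u'\<close>, hence both periodic boundary conditions.
\<close>

definition schroedinger :: "(real \<Rightarrow> real) \<Rightarrow> operator_graph" where
  "schroedinger V = {(\<psi>, \<eta>). \<psi> \<in> L2_circle \<and> \<eta> \<in> L2_circle \<and>
     (\<exists>u u' u''. periodic_2pi u \<and> has_ac_derivatives u u' u'' \<and>
        (AE x in lebesgue. \<psi> x = u x) \<and>
        (AE x in lebesgue. \<eta> x = - u'' x + complex_of_real (V x) * u x))}"

end

theory Submission
  imports Defs
begin

text \<open>
  Put \<open>g = \<phi>' / \<phi>\<close>.  For \<open>u\<close> in the domain, \<open>(g |u|\<^sup>2)' = (\<phi>'' / \<phi>) |u|\<^sup>2 + |u'|\<^sup>2 - |u' - g u|\<^sup>2\<close>,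
  which is at most \<open>(V - E\<^sub>\<phi>) |u|\<^sup>2 + |u'|\<^sup>2\<close>; integrating over a period gives
  \<open>\<langle>u, H u\<rangle> \<ge> E\<^sub>\<phi> \<parallel>u\<parallel>\<^sup>2\<close>.  As \<open>\<phi>''\<close> is only a pointwise derivative, it need not be Lebesgue
  integrable; the Henstock--Kurzweil integral still recovers \<open>g |u|\<^sup>2\<close> from its derivative.
\<close>

section \<open>Integration by parts against an indefinite Lebesgue integral\<close>

lemma absolutely_integrable_continuous_mult:
  fixes f g :: "real \<Rightarrow> 'a::{real_normed_field, euclidean_space}"
  assumes f: "continuous_on {a..b} f" and g: "g absolutely_integrable_on {a..b}"
  shows "(\<lambda>x. f x * g x) absolutely_integrable_on {a..b}"
proof (rule absolutely_integrable_bounded_measurable_product[OF bilinear_times _ _ _ g])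
  show "f \<in> borel_measurable (lebesgue_on {a..b})"
    by (intro continuous_imp_measurable_on_sets_lebesgue f) auto
  show "bounded (f ` {a..b})"
    by (intro compact_imp_bounded compact_continuous_image f) auto
qed auto

text \<open>
  The increment over \<open>[x, y]\<close> of the difference \<open>\<delta>\<close> of the two sides is at most
  \<open>2 L (y - x) (G y - G x)\<close> with \<open>G\<close> the continuous indefinite integral of \<open>|g'|\<close>, so \<open>\<delta>\<close> has
  derivative zero; almost everywhere differentiability of \<open>g\<close> is never used.
\<close>

lemma integration_by_parts_indefinite_integral:
  fixes f f' g g' :: "real \<Rightarrow> 'a::{real_normed_field, euclidean_space}"
  assumes "a \<le> b"
    and f: "\<And>x. x \<in> {a..b} \<Longrightarrow> (f has_vector_derivative f' x) (at x within {a..b})"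
    and f'_cont: "continuous_on {a..b} f'"
    and g'_int: "g' absolutely_integrable_on {a..b}"
    and g: "\<And>x. x \<in> {a..b} \<Longrightarrow> integral {a..x} g' = g x - g a"
  shows "integral {a..b} (\<lambda>x. f x * g' x) =
    f b * g b - f a * g a - integral {a..b} (\<lambda>x. f' x * g x)"
proof -
  have f_cont: "continuous_on {a..b} f"
    using f by (rule continuous_on_vector_derivative)
  have g'_hk: "g' integrable_on {a..b}"
    and ng'_hk: "(\<lambda>x. norm (g' x)) integrable_on {a..b}"
    using g'_int by (auto simp: absolutely_integrable_on_def)
  have g_cont: "continuous_on {a..b} g"
  proof -
    have "continuous_on {a..b} (\<lambda>x. g a + integral {a..x} g')"
      by (intro continuous_intros indefinite_integral_continuous_1 g'_hk)
    then show ?thesis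
      by (rule continuous_on_eq) (simp add: g)
  qed
  have fg': "(\<lambda>x. f x * g' x) integrable_on {a..b}"
    using absolutely_integrable_continuous_mult[OF f_cont g'_int]
    by (simp add: absolutely_integrable_on_def)
  have f'g: "(\<lambda>x. f' x * g x) integrable_on {a..b}"
    by (intro integrable_continuous_real continuous_intros f'_cont g_cont)
  define G where "G x = integral {a..x} (\<lambda>x. norm (g' x))" for x
  have G_cont: "continuous_on {a..b} G"
    unfolding G_def by (rule indefinite_integral_continuous_1[OF ng'_hk])
  obtain L where "L > 0" and L: "\<And>x. x \<in> {a..b} \<Longrightarrow> norm (f' x) \<le> L"
    using compact_imp_bounded[OF compact_continuous_image[OF f'_cont]]
    by (auto simp: bounded_pos)
  have f_lip: "norm (f y - f x) \<le> L * (y - x)" if "a \<le> x" "x \<le> y" "y \<le> b" for x y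
  proof -
    have "(f' has_integral (f y - f x)) {x..y}"
      using that
      by (intro fundamental_theorem_of_calculus has_vector_derivative_within_subset[OF f]) auto
    then show ?thesis
      using has_integral_bound_real[of L "{}" f' "f y - f x" x y] that \<open>L > 0\<close> L by auto
  qed
  have g_diff: "integral {x..y} g' = g y - g x" if "a \<le> x" "x \<le> y" "y \<le> b" for x y
  proof -
    have "integral {a..x} g' + integral {x..y} g' = integral {a..y} g'"
      using that by (intro Henstock_Kurzweil_Integration.integral_combine
          integrable_subinterval_real[OF g'_hk]) auto
    then show ?thesis
      using that by (simp add: g algebra_simps)
  qed
  have G_diff: "integral {x..y} (\<lambda>x. norm (g' x)) = G y - G x" if "a \<le> x" "x \<le> y" "y \<le> b" for x y
  proof -
    have "G x + integral {x..y} (\<lambda>x. norm (g' x)) = G y"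
      unfolding G_def using that by (intro Henstock_Kurzweil_Integration.integral_combine
          integrable_subinterval_real[OF ng'_hk]) auto
    then show ?thesis
      by (simp add: algebra_simps)
  qed
  have G_mono: "G x \<le> G y" if "a \<le> x" "x \<le> y" "y \<le> b" for x y
    using G_diff[OF that] integral_nonneg[of "\<lambda>x. norm (g' x)" "{x..y}"]
      integrable_subinterval_real[OF ng'_hk, of x y] that by auto
  have g_G: "norm (g y - g x) \<le> G y - G x" if "a \<le> x" "x \<le> y" "y \<le> b" for x y
    unfolding G_diff[OF that, symmetric] g_diff[OF that, symmetric]
    using that by (intro Henstock_Kurzweil_Integration.integral_norm_bound_integral
      integrable_subinterval_real[OF ng'_hk] integrable_subinterval_real[OF g'_hk]) auto
  define \<delta> where "\<delta> x = integral {a..x} (\<lambda>s. f s * g' s + f' s * g s) - f x * g x" for x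
  have int: "(\<lambda>s. f s * g' s + f' s * g s) integrable_on {a..b}"
    by (intro integrable_add fg' f'g)
  have \<delta>_bound: "norm (\<delta> y - \<delta> x) \<le> 2 * L * (y - x) * (G y - G x)"
    if "a \<le> x" "x \<le> y" "y \<le> b" for x y
  proof -
    have sub: "{x..y} \<subseteq> {a..b}"
      using that by auto
    have "integral {a..x} (\<lambda>s. f s * g' s + f' s * g s) +
        integral {x..y} (\<lambda>s. f s * g' s + f' s * g s) =
        integral {a..y} (\<lambda>s. f s * g' s + f' s * g s)"
      using that by (intro Henstock_Kurzweil_Integration.integral_combine
          integrable_subinterval_real[OF int]) auto
    then have "\<delta> y - \<delta> x =
        integral {x..y} (\<lambda>s. f s * g' s + f' s * g s) - (f y * (g y - g x) + (f y - f x) * g x)"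
      unfolding \<delta>_def by (simp add: algebra_simps)
    \<comment> \<open>Freezing \<open>f\<close> at the right endpoint and \<open>g\<close> at the
      left one leaves an integrand with an explicit integral, which telescopes to the exact
      increment \<open>f y * g y - f x * g x\<close>. So \<open>\<delta> y - \<delta> x\<close> is
      the integral of the freezing error alone.\<close>
    moreover have int1: "((\<lambda>s. f y * g' s + f' s * g x) has_integral
        (f y * (g y - g x) + (f y - f x) * g x)) {x..y}"
    proof (intro has_integral_add has_integral_mult_right has_integral_mult_left)
      show "(g' has_integral (g y - g x)) {x..y}"
        unfolding g_diff[OF that, symmetric]
        by (intro integrable_integral integrable_subinterval_real[OF g'_hk] sub)
      show "(f' has_integral (f y - f x)) {x..y}"
        using that sub
        by (intro fundamental_theorem_of_calculus has_vector_derivative_within_subset[OF f]) auto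
    qed
    moreover have int2: "((\<lambda>s. f s * g' s + f' s * g s) has_integral
        integral {x..y} (\<lambda>s. f s * g' s + f' s * g s)) {x..y}"
      by (intro integrable_integral integrable_subinterval_real[OF int] sub)
    ultimately have diff: "((\<lambda>s. (f s * g' s + f' s * g s) - (f y * g' s + f' s * g x))
        has_integral (\<delta> y - \<delta> x)) {x..y}"
      using has_integral_diff[OF int2 int1] by (simp only:)
    \<comment> \<open>The majorant of the freezing error. Each of its two terms integrates to
      \<open>L * (y - x) * (G y - G x)\<close>, hence the factor 2 in the bound.\<close>
    have bnd: "((\<lambda>s. L * (y - x) * norm (g' s) + L * (G y - G x)) has_integral
        (L * (y - x) * (G y - G x) + L * (G y - G x) * (y - x))) {x..y}"
    proof (intro has_integral_add has_integral_mult_right)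
      show "((\<lambda>s. norm (g' s)) has_integral (G y - G x)) {x..y}"
        unfolding G_diff[OF that, symmetric]
        by (intro integrable_integral integrable_subinterval_real[OF ng'_hk] sub)
      show "((\<lambda>s. L * (G y - G x)) has_integral (L * (G y - G x) * (y - x))) {x..y}"
        using that has_integral_const_real[of "L * (G y - G x)" x y] by (simp add: mult_ac)
    qed
    have "norm ((f s * g' s + f' s * g s) - (f y * g' s + f' s * g x)) \<le>
        L * (y - x) * norm (g' s) + L * (G y - G x)" if s: "s \<in> {x..y}" for s
    proof -
      have "norm (f y - f s) \<le> L * (y - s)"
        using s \<open>a \<le> x\<close> \<open>y \<le> b\<close> by (intro f_lip) auto
      also have "\<dots> \<le> L * (y - x)"
        using s \<open>L > 0\<close> by (intro mult_left_mono) auto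
      finally have 1: "norm (f y - f s) \<le> L * (y - x)" .
      have "norm (g s - g x) \<le> G s - G x"
        using s \<open>a \<le> x\<close> \<open>y \<le> b\<close> by (intro g_G) auto
      also have "\<dots> \<le> G y - G x"
        using s \<open>a \<le> x\<close> \<open>y \<le> b\<close> by (intro diff_right_mono G_mono) auto
      finally have 2: "norm (g s - g x) \<le> G y - G x" .
      \<comment> \<open>In this rewriting each term carries one increment: that of \<open>g\<close>
        is controlled by \<open>G\<close>, that of \<open>f\<close> by the Lipschitz constant
        \<open>L\<close>.\<close>
      have "(f s * g' s + f' s * g s) - (f y * g' s + f' s * g x) =
          f' s * (g s - g x) - (f y - f s) * g' s"
        by (simp add: algebra_simps)
      also have "norm \<dots> \<le> norm (f' s) * norm (g s - g x) + norm (f y - f s) * norm (g' s)"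
        by (metis norm_mult norm_triangle_ineq4)
      also have "\<dots> \<le> L * (G y - G x) + L * (y - x) * norm (g' s)"
        using 1 2 L[of s] sub s \<open>L > 0\<close>
        by (intro add_mono mult_mono mult_right_mono) auto
      finally show ?thesis
        by simp
    qed
    then have "norm (integral {x..y} (\<lambda>s. (f s * g' s + f' s * g s) - (f y * g' s + f' s * g x)))
      \<le> integral {x..y} (\<lambda>s. L * (y - x) * norm (g' s) + L * (G y - G x))"
      using diff bnd by (intro Henstock_Kurzweil_Integration.integral_norm_bound_integral) auto
    then show ?thesis
      using diff bnd by (simp add: integral_unique algebra_simps)
  qed
  \<comment> \<open>The same bound for either order of the points. After division by
    \<open>norm (y - x)\<close> what remains is a multiple of \<open>norm (G y - G x)\<close>, which
    tends to zero by continuity of \<open>G\<close>.\<close>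
  have \<delta>_bound': "norm (\<delta> y - \<delta> x) \<le> norm (y - x) * (2 * L * norm (G y - G x))"
    if "x \<in> {a..b}" "y \<in> {a..b}" for x y
  proof (cases "x \<le> y")
    case True
    then show ?thesis
      using \<delta>_bound[of x y] G_mono[of x y] that by (simp add: algebra_simps)
  next
    case False
    then show ?thesis
      using \<delta>_bound[of y x] G_mono[of y x] that by (simp add: algebra_simps norm_minus_commute)
  qed
  have "(\<delta> has_derivative (\<lambda>h. 0)) (at x within {a..b})" if x: "x \<in> {a..b}" for x
    unfolding has_derivative_within
  proof
    have "(G \<longlongrightarrow> G x) (at x within {a..b})"
      using G_cont x by (simp add: continuous_on_def)
    then have "((\<lambda>y. G y - G x) \<longlongrightarrow> 0) (at x within {a..b})"
      by (rule LIM_zero)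
    then have "((\<lambda>y. 2 * L * norm (G y - G x)) \<longlongrightarrow> 0) (at x within {a..b})"
      by (intro tendsto_mult_right_zero tendsto_norm_zero)
    moreover have "\<forall>\<^sub>F y in at x within {a..b}.
        norm ((1 / norm (y - x)) *\<^sub>R (\<delta> y - (\<delta> x + 0))) \<le> 2 * L * norm (G y - G x)"
      unfolding eventually_at_filter
    proof (intro always_eventually allI impI)
      fix y assume "y \<noteq> x" "y \<in> {a..b}"
      with \<delta>_bound'[OF x, of y]
      show "norm ((1 / norm (y - x)) *\<^sub>R (\<delta> y - (\<delta> x + 0))) \<le> 2 * L * norm (G y - G x)"
        by (simp add: pos_divide_le_eq mult.commute)
    qed
    ultimately show "((\<lambda>y. (1 / norm (y - x)) *\<^sub>R (\<delta> y - (\<delta> x + 0))) \<longlongrightarrow> 0) (at x within {a..b})"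
      by (rule Lim_null_comparison[rotated])
  qed simp
  then obtain c where "\<And>x. x \<in> {a..b} \<Longrightarrow> \<delta> x = c"
    using has_derivative_zero_constant[of "{a..b}" \<delta>] by auto
  \<comment> \<open>At \<open>a\<close> the integral in \<open>\<delta>\<close> is over a single
    point, so \<open>\<delta> a\<close> is just \<open>- f a * g a\<close>.\<close>
  then have "\<delta> b = \<delta> a"
    using \<open>a \<le> b\<close> by simp
  then show ?thesis
    using integral_add[OF fg' f'g] by (simp add: \<delta>_def algebra_simps)
qed

section \<open>The comparison inequality on an interval\<close>

text \<open>Equal boundary values stand in for periodicity, and the null set \<open>N\<close> allows
  for an equation known only almost everywhere. Integration by parts turns the second-order term
  into minus the kinetic energy \<open>K\<close>; the rest is a pointwise inequality between
  \<open>H\<close> and the derivative \<open>F'\<close>, whose integral vanishes.\<close>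

lemma ground_state_comparison:
  fixes V \<phi> \<phi>' \<phi>'' :: "real \<Rightarrow> real" and u u' u'' \<eta> :: "real \<Rightarrow> complex"
  assumes "a \<le> b"
    and \<phi>: "\<And>x. x \<in> {a..b} \<Longrightarrow> (\<phi> has_real_derivative \<phi>' x) (at x within {a..b})"
    and \<phi>': "\<And>x. x \<in> {a..b} \<Longrightarrow> (\<phi>' has_real_derivative \<phi>'' x) (at x within {a..b})"
    and \<phi>_pos: "\<And>x. x \<in> {a..b} \<Longrightarrow> \<phi> x > 0"
    and \<phi>_boundary: "\<phi> b = \<phi> a" "\<phi>' b = \<phi>' a"
    and u: "\<And>x. x \<in> {a..b} \<Longrightarrow> (u has_vector_derivative u' x) (at x within {a..b})"
    and u''_int: "u'' absolutely_integrable_on {a..b}"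
    and u': "\<And>x. x \<in> {a..b} \<Longrightarrow> integral {a..x} u'' = u' x - u' a"
    and u_boundary: "u b = u a" "u' b = u' a"
    and \<eta>_int: "\<eta> absolutely_integrable_on {a..b}"
    and "negligible N"
    and \<eta>: "\<And>x. x \<in> {a..b} - N \<Longrightarrow> \<eta> x = - u'' x + of_real (V x) * u x"
    and e: "\<And>x. x \<in> {a..b} \<Longrightarrow> e \<le> V x - \<phi>'' x / \<phi> x"
  shows "e * integral {a..b} (\<lambda>x. (cmod (u x))\<^sup>2) \<le> integral {a..b} (\<lambda>x. Re (cnj (u x) * \<eta> x))"
proof -
  have u_cont: "continuous_on {a..b} u"
    using u by (rule continuous_on_vector_derivative)
  have u'_cont: "continuous_on {a..b} u'"
  proof -
    have "continuous_on {a..b} (\<lambda>x. u' a + integral {a..x} u'')"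
      using u''_int
      by (intro continuous_intros indefinite_integral_continuous_1)
        (simp add: absolutely_integrable_on_def)
    then show ?thesis
      by (rule continuous_on_eq) (simp add: u')
  qed
  have cnj_u_cont: "continuous_on {a..b} (\<lambda>x. cnj (u x))"
    by (intro continuous_intros u_cont)
  define K where "K = integral {a..b} (\<lambda>x. (cmod (u' x))\<^sup>2)"
  have K: "((\<lambda>x. (cmod (u' x))\<^sup>2) has_integral K) {a..b}"
    unfolding K_def
    by (intro integrable_integral integrable_continuous_real continuous_intros u'_cont)
  have u_sq: "((\<lambda>x. (cmod (u x))\<^sup>2) has_integral integral {a..b} (\<lambda>x. (cmod (u x))\<^sup>2)) {a..b}"
    by (intro integrable_integral integrable_continuous_real continuous_intros u_cont)
  have u\<eta>: "((\<lambda>x. Re (cnj (u x) * \<eta> x)) has_integral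
      integral {a..b} (\<lambda>x. Re (cnj (u x) * \<eta> x))) {a..b}"
    using absolutely_integrable_continuous_mult[OF cnj_u_cont \<eta>_int]
      integrable_linear[OF _ bounded_linear_Re, of "\<lambda>x. cnj (u x) * \<eta> x" "{a..b}"]
    by (intro integrable_integral) (auto simp: absolutely_integrable_on_def o_def)
  \<comment> \<open>By parts with \<open>cnj u\<close> as the smooth factor and \<open>u'\<close> as
    the indefinite integral; the boundary terms cancel because \<open>u\<close> and
    \<open>u'\<close> agree at both ends.\<close>
  have uu'': "((\<lambda>x. Re (cnj (u x) * u'' x)) has_integral - K) {a..b}"
  proof -
    have "integral {a..b} (\<lambda>x. cnj (u x) * u'' x) =
        cnj (u b) * u' b - cnj (u a) * u' a - integral {a..b} (\<lambda>x. cnj (u' x) * u' x)"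
      using \<open>a \<le> b\<close> u'_cont u''_int u' u
      by (intro integration_by_parts_indefinite_integral)
        (auto intro!: continuous_intros has_vector_derivative_cnj)
    also have "(\<lambda>x. cnj (u' x) * u' x) = (\<lambda>x. of_real ((cmod (u' x))\<^sup>2))"
      by (simp only: mult.commute[of "cnj _"] complex_norm_square)
    also have "integral {a..b} (\<lambda>x. complex_of_real ((cmod (u' x))\<^sup>2)) = of_real K"
      using has_integral_linear[OF K bounded_linear_of_real] by (intro integral_unique) (simp only: o_def)
    finally have "integral {a..b} (\<lambda>x. cnj (u x) * u'' x) = - of_real K"
      by (simp add: u_boundary)
    moreover have "(\<lambda>x. cnj (u x) * u'' x) integrable_on {a..b}"
      using absolutely_integrable_continuous_mult[OF cnj_u_cont u''_int]
      by (simp add: absolutely_integrable_on_def)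
    ultimately have "((\<lambda>x. cnj (u x) * u'' x) has_integral - of_real K) {a..b}"
      by (metis integrable_integral)
    from has_integral_linear[OF this bounded_linear_Re] show ?thesis
      by (simp add: o_def)
  qed
  define F where "F x = \<phi>' x / \<phi> x * (cmod (u x))\<^sup>2" for x
  define F' where "F' x = (\<phi>'' x / \<phi> x - (\<phi>' x / \<phi> x)\<^sup>2) * (cmod (u x))\<^sup>2 +
      \<phi>' x / \<phi> x * (2 * Re (cnj (u x) * u' x))" for x
  \<comment> \<open>Gauge integrability of \<open>F'\<close> comes for free here, since
    \<open>F'\<close> is the derivative of \<open>F\<close> at every point of the interval. The
    boundary conditions then make the integral zero.\<close>
  have "(F' has_integral (F b - F a)) {a..b}"
  proof (rule fundamental_theorem_of_calculus[OF \<open>a \<le> b\<close>])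
    fix x assume x: "x \<in> {a..b}"
    have "((\<lambda>x. \<phi>' x / \<phi> x) has_real_derivative (\<phi>'' x / \<phi> x - (\<phi>' x / \<phi> x)\<^sup>2)) (at x within {a..b})"
      using \<phi>_pos[OF x]
      by (auto intro!: derivative_eq_intros \<phi>[OF x] \<phi>'[OF x] simp: field_simps power2_eq_square)
    moreover have "((\<lambda>x. (cmod (u x))\<^sup>2) has_real_derivative 2 * Re (cnj (u x) * u' x)) (at x within {a..b})"
    proof -
      show ?thesis
        unfolding cmod_power2
        by (auto intro!: derivative_eq_intros u[OF x])
    qed
    ultimately have "(F has_real_derivative F' x) (at x within {a..b})"
      unfolding F_def F'_def by (rule DERIV_cong[OF DERIV_mult]) (simp add: algebra_simps)
    then show "(F has_vector_derivative F' x) (at x within {a..b})"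
      by (simp add: has_real_derivative_iff_has_vector_derivative)
  qed
  then have F': "(F' has_integral 0) {a..b}"
    by (simp add: F_def \<phi>_boundary u_boundary)
  \<comment> \<open>Off \<open>N\<close> this is
    \<open>(V x - e) * (cmod (u x))\<^sup>2 + (cmod (u' x))\<^sup>2\<close>. It is written through
    \<open>\<eta>\<close> and \<open>u''\<close> so that every term has a known integral, whereas
    \<open>V\<close> by itself carries no regularity.\<close>
  define H where "H x = Re (cnj (u x) * \<eta> x) + Re (cnj (u x) * u'' x) + (cmod (u' x))\<^sup>2
      - e * (cmod (u x))\<^sup>2" for x
  have H: "(H has_integral (integral {a..b} (\<lambda>x. Re (cnj (u x) * \<eta> x)) + - K + K
      - e * integral {a..b} (\<lambda>x. (cmod (u x))\<^sup>2))) {a..b}"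
    unfolding H_def
    by (intro has_integral_add has_integral_diff has_integral_mult_right u\<eta> uu'' K u_sq)
  \<comment> \<open>The equation for \<open>\<eta>\<close> says nothing on \<open>N\<close>.
    Replacing \<open>F'\<close> by \<open>H\<close> there keeps the integral and makes the
    comparison hold at every point.\<close>
  have "((\<lambda>x. if x \<in> N then H x else F' x) has_integral 0) {a..b}"
    using \<open>negligible N\<close> by (rule has_integral_spike[OF _ _ F']) auto
  then have "0 \<le> integral {a..b} (\<lambda>x. Re (cnj (u x) * \<eta> x)) + - K + K
      - e * integral {a..b} (\<lambda>x. (cmod (u x))\<^sup>2)"
  proof (rule has_integral_le[OF _ H])
    fix x assume x: "x \<in> {a..b}"
    have "F' x \<le> H x" if "x \<notin> N"
    proof -
      define p where "p = \<phi>' x / \<phi> x"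
      have V_u: "Re (cnj (u x) * \<eta> x) + Re (cnj (u x) * u'' x) = V x * ((Re (u x))\<^sup>2 + (Im (u x))\<^sup>2)"
        using x that by (simp add: \<eta> power2_eq_square algebra_simps)
      \<comment> \<open>Completing the square: the terms in \<open>u'\<close> and \<open>p\<close>
        combine to the modulus squared of \<open>u' - p u\<close>, which vanishes when
        \<open>u\<close> is a multiple of \<open>\<phi>\<close>.\<close>
      have "H x - F' x = (V x - \<phi>'' x / \<phi> x - e) * (cmod (u x))\<^sup>2 + (cmod (u' x - of_real p * u x))\<^sup>2"
        using V_u
        unfolding H_def F'_def p_def[symmetric] cmod_power2
        by (simp add: power2_eq_square algebra_simps)
      also have "\<dots> \<ge> 0"
        using e[OF x] by simp
      finally show ?thesis
        by simp
    qed
    then show "(if x \<in> N then H x else F' x) \<le> H x"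
      by simp
  qed
  then show ?thesis
    by simp
qed


section \<open>Periodicity and square-integrable functions on the circle\<close>

lemma periodic_vector_derivative:
  assumes per: "periodic_2pi f" and f: "\<And>x. (f has_vector_derivative f' x) (at x)"
  shows "periodic_2pi f'"
  unfolding periodic_2pi_def
proof
  fix x
  have "((\<lambda>x. x + 2 * pi) has_vector_derivative 1) (at x)"
    by (auto intro!: derivative_eq_intros)
  from vector_diff_chain_at[OF this f] have "(f has_vector_derivative f' (x + 2 * pi)) (at x)"
    using per by (simp add: o_def periodic_2pi_def)
  then show "f' (x + 2 * pi) = f' x"
    using f vector_derivative_unique_at by blast
qed

lemma periodic_2pi_endpoints: "periodic_2pi f \<Longrightarrow> f (2 * pi) = f 0"
  unfolding periodic_2pi_def by (metis add_0)

lemma L2_circle_integrable: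
  "f \<in> L2_circle \<Longrightarrow> (\<lambda>x. (cmod (f x))\<^sup>2) integrable_on {0..2 * pi}"
  by (auto simp: L2_circle_def dest: set_lebesgue_integral_eq_integral(1))

text \<open>A period has finite length, so the pointwise bound \<open>t \<le> 1 + t\<^sup>2\<close>
  puts square-integrable functions into \<open>L^1\<close>.\<close>

lemma L2_circle_absolutely_integrable:
  assumes "f \<in> L2_circle"
  shows "f absolutely_integrable_on {0..2 * pi}"
proof (rule measurable_bounded_by_integrable_imp_absolutely_integrable)
  show "f \<in> borel_measurable (lebesgue_on {0..2 * pi})"
    using assms by (auto simp: L2_circle_def intro: measurable_restrict_space1)
  show "(\<lambda>x. 1 + (cmod (f x))\<^sup>2) integrable_on {0..2 * pi}"
    by (intro integrable_add L2_circle_integrable assms) auto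
  show "cmod (f x) \<le> 1 + (cmod (f x))\<^sup>2" for x
    using zero_le_power2[of "cmod (f x) - 1"] zero_le_power2[of "cmod (f x)"]
    unfolding power2_diff by (smt (verit) one_power2 norm_ge_zero)
qed auto

lemma L2_norm_nonneg: "L2_norm f \<ge> 0"
  by (simp add: L2_norm_def set_lebesgue_integral_def)

lemma L2_norm_power2:
  assumes "f \<in> L2_circle"
  shows "(L2_norm f)\<^sup>2 = integral {0..2 * pi} (\<lambda>x. (cmod (f x))\<^sup>2)"
proof -
  have int: "set_integrable lebesgue {0..2 * pi} (\<lambda>x. (cmod (f x))\<^sup>2)"
    using assms by (simp add: L2_circle_def)
  show ?thesis
    unfolding L2_norm_def set_lebesgue_integral_eq_integral(2)[OF int]
    using L2_circle_integrable[OF assms]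
    by (simp add: Henstock_Kurzweil_Integration.integral_nonneg)
qed

lemma norm_diff_power2_le: "(norm (x - y))\<^sup>2 \<le> 2 * (norm x)\<^sup>2 + 2 * (norm y)\<^sup>2"
proof -
  have "(norm (x - y))\<^sup>2 \<le> (norm x + norm y)\<^sup>2"
    by (intro power_mono norm_triangle_ineq4 norm_ge_zero)
  also have "\<dots> \<le> 2 * (norm x)\<^sup>2 + 2 * (norm y)\<^sup>2"
    using sum_squares_bound[of "norm x" "norm y"] by (simp add: power2_sum)
  finally show ?thesis .
qed

lemma L2_circle_diff:
  assumes f: "f \<in> L2_circle" and g: "g \<in> L2_circle"
  shows "(\<lambda>x. f x - g x) \<in> L2_circle"
proof -
  have meas: "(\<lambda>x. f x - g x) \<in> borel_measurable lebesgue"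
    by (intro borel_measurable_diff) (use f g in \<open>simp_all add: L2_circle_def\<close>)
  have "(\<lambda>x. (cmod (f x - g x))\<^sup>2) absolutely_integrable_on {0..2 * pi}"
  proof (rule measurable_bounded_by_integrable_imp_absolutely_integrable)
    show "(\<lambda>x. (cmod (f x - g x))\<^sup>2) \<in> borel_measurable (lebesgue_on {0..2 * pi})"
      by (intro measurable_restrict_space1 borel_measurable_power
          measurable_compose[OF meas borel_measurable_norm])
    show "(\<lambda>x. 2 * (cmod (f x))\<^sup>2 + 2 * (cmod (g x))\<^sup>2) integrable_on {0..2 * pi}"
      using L2_circle_integrable[OF f] L2_circle_integrable[OF g]
      by (intro integrable_add integrable_on_mult_right)
  qed (auto simp: norm_diff_power2_le)
  then show ?thesis
    using f g meas by (simp add: L2_circle_def periodic_2pi_def)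
qed

lemma L2_norm_scaleR: "L2_norm (\<lambda>x. of_real c * f x) = \<bar>c\<bar> * L2_norm f"
  by (simp add: L2_norm_def norm_mult power_mult_distrib real_sqrt_mult)

lemma L2_circle_scaleR: "f \<in> L2_circle \<Longrightarrow> (\<lambda>x. of_real c * f x) \<in> L2_circle"
  by (auto simp: L2_circle_def periodic_2pi_def norm_mult power_mult_distrib)

section \<open>Unit vectors in the domain of a self-adjoint operator\<close>

text \<open>The defining identity is homogeneous in the first argument of the inner product. As a
  self-adjoint graph equals its adjoint graph, this gives the scaling needed to normalize a vector
  in its domain.\<close>

lemma adjoint_graph_scaleR:
  assumes "(\<xi>, \<zeta>) \<in> adjoint_graph G"
  shows "(\<lambda>x. of_real c * \<xi> x, \<lambda>x. of_real c * \<zeta> x) \<in> adjoint_graph G"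
proof -
  have "L2_inner (\<lambda>x. of_real c * f x) g = of_real c * L2_inner f g" for f g
    by (simp add: L2_inner_def mult.assoc)
  then show ?thesis
    using assms by (auto simp: adjoint_graph_def L2_circle_scaleR)
qed

text \<open>Ensures that the infimum in \<open>ground_state_energy\<close> is over a nonempty set.
  Density gives a domain vector at distance less than 1 from the constant function 1; that function
  has norm \<open>sqrt (2 * pi) > 1\<close>, so the vector is not null and can be
  normalized.\<close>

lemma self_adjoint_unit_vector:
  assumes "self_adjoint G"
  obtains \<psi> \<eta> where "(\<psi>, \<eta>) \<in> G" "L2_norm \<psi> = 1"
proof -
  have one: "(\<lambda>_. 1) \<in> L2_circle"
    by (auto simp: L2_circle_def periodic_2pi_def intro: absolutely_integrable_continuous_real)
  moreover have "\<forall>f\<in>L2_circle. \<forall>\<epsilon>>0. \<exists>\<psi>\<in>Domain G. L2_norm (\<lambda>x. f x - \<psi> x) < \<epsilon>"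
    using assms by (simp add: self_adjoint_def densely_defined_def)
  ultimately have "\<exists>\<psi>\<in>Domain G. L2_norm (\<lambda>x. 1 - \<psi> x) < 1"
    using zero_less_one by (drule_tac bspec) (assumption, drule spec, erule mp)
  then obtain \<psi> \<eta> where G: "(\<psi>, \<eta>) \<in> G" and near: "L2_norm (\<lambda>x. 1 - \<psi> x) < 1"
    by blast
  have \<psi>: "\<psi> \<in> L2_circle"
    using assms G by (auto simp: self_adjoint_def adjoint_graph_def)
  have "L2_norm \<psi> \<noteq> 0"
  proof
    assume "L2_norm \<psi> = 0"
    then have "((\<lambda>x. (cmod (\<psi> x))\<^sup>2) has_integral 0) {0..2 * pi}"
      using L2_norm_power2[OF \<psi>] L2_circle_integrable[OF \<psi>]
      by (simp add: has_integral_iff)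
    \<comment> \<open>The constant 1/2 comes from splitting 1 as
      \<open>(1 - \<psi> x) + \<psi> x\<close>, which gives \<open>1 \<le> 2 * (cmod (1 - \<psi>
      x))\<^sup>2 + 2 * (cmod (\<psi> x))\<^sup>2\<close>. Halved and integrated over a period, with
      \<open>\<psi>\<close> null, this puts \<open>pi\<close> below a squared distance that is at
      most 1.\<close>
    with has_integral_const_real[of "1 / 2 :: real" 0 "2 * pi"]
    have "((\<lambda>x. 1 / 2 - (cmod (\<psi> x))\<^sup>2) has_integral pi - 0) {0..2 * pi}"
      by (intro has_integral_diff) auto
    moreover have "((\<lambda>x. (cmod (1 - \<psi> x))\<^sup>2) has_integral (L2_norm (\<lambda>x. 1 - \<psi> x))\<^sup>2) {0..2 * pi}"
      using L2_norm_power2[OF L2_circle_diff[OF one \<psi>]] L2_circle_integrable[OF L2_circle_diff[OF one \<psi>]]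
      by (simp add: has_integral_iff)
    ultimately have "pi - 0 \<le> (L2_norm (\<lambda>x. 1 - \<psi> x))\<^sup>2"
    proof (rule has_integral_le)
      show "1 / 2 - (cmod (\<psi> x))\<^sup>2 \<le> (cmod (1 - \<psi> x))\<^sup>2" for x
        using norm_diff_power2_le[of "1 - \<psi> x" "- \<psi> x"] by simp
    qed
    also have "(L2_norm (\<lambda>x. 1 - \<psi> x))\<^sup>2 \<le> 1\<^sup>2"
      using near by (intro power_mono) (auto simp: L2_norm_nonneg)
    finally show False
      using pi_gt3 by simp
  qed
  moreover have "(\<lambda>x. of_real (1 / L2_norm \<psi>) * \<psi> x, \<lambda>x. of_real (1 / L2_norm \<psi>) * \<eta> x) \<in> G"
    using adjoint_graph_scaleR[of \<psi> \<eta> G] G assms by (simp only: self_adjoint_def)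
  ultimately show ?thesis
    using that L2_norm_scaleR[of "1 / L2_norm \<psi>" \<psi>] L2_norm_nonneg[of \<psi>] by auto
qed

section \<open>Lower bound for the Schroedinger form and its ground state energy\<close>

text \<open>Transfers the interval inequality from the regular representative \<open>u\<close> to
  its class: one null set \<open>N\<close> covers both almost-everywhere identities, and changing
  integrands on it affects neither the norm nor the inner product.\<close>

lemma schroedinger_form_lower_bound:
  fixes V \<phi> \<phi>' \<phi>'' :: "real \<Rightarrow> real"
  assumes G: "(\<psi>, \<eta>) \<in> schroedinger V"
    and \<phi>_per: "periodic_2pi \<phi>"
    and \<phi>: "\<And>x. (\<phi> has_real_derivative \<phi>' x) (at x)"
    and \<phi>': "\<And>x. (\<phi>' has_real_derivative \<phi>'' x) (at x)"
    and \<phi>_pos: "\<And>x. \<phi> x > 0"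
    and e: "\<And>x. e \<le> V x - \<phi>'' x / \<phi> x"
  shows "e * (L2_norm \<psi>)\<^sup>2 \<le> Re (L2_inner \<psi> \<eta>)"
proof -
  obtain u u' u'' where u_per: "periodic_2pi u" and ac: "has_ac_derivatives u u' u''"
    and \<psi>u: "AE x in lebesgue. \<psi> x = u x"
    and \<eta>u: "AE x in lebesgue. \<eta> x = - u'' x + complex_of_real (V x) * u x"
    and \<psi>: "\<psi> \<in> L2_circle" and \<eta>: "\<eta> \<in> L2_circle"
    using G unfolding schroedinger_def by blast
  from \<psi>u \<eta>u have "AE x in lebesgue. \<psi> x = u x \<and> \<eta> x = - u'' x + complex_of_real (V x) * u x"
    by (rule AE_conjI)
  then obtain N where N: "negligible N"
    and N_\<psi>: "\<And>x. x \<notin> N \<Longrightarrow> \<psi> x = u x"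
    and N_\<eta>: "\<And>x. x \<notin> N \<Longrightarrow> \<eta> x = - u'' x + complex_of_real (V x) * u x"
    unfolding eventually_ae_filter_negligible by blast
  have u: "(u has_vector_derivative u' x) (at x)" for x
    using ac by (simp add: has_ac_derivatives_def)
  have u''_int: "u'' absolutely_integrable_on {c..d}" if "c \<le> d" for c d
    using ac that by (simp add: has_ac_derivatives_def)
  have u': "integral {c..d} u'' = u' d - u' c" if "c \<le> d" for c d
    using ac that set_lebesgue_integral_eq_integral(2)[OF u''_int[OF that]]
    by (simp add: has_ac_derivatives_def)
  have \<eta>_int: "\<eta> absolutely_integrable_on {0..2 * pi}"
    by (rule L2_circle_absolutely_integrable[OF \<eta>])
  have "periodic_2pi \<phi>'"
    using \<phi>_per \<phi> unfolding has_real_derivative_iff_has_vector_derivative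
    by (rule periodic_vector_derivative)
  have bound: "e * integral {0..2 * pi} (\<lambda>x. (cmod (u x))\<^sup>2)
      \<le> integral {0..2 * pi} (\<lambda>x. Re (cnj (u x) * \<eta> x))"
  proof (rule ground_state_comparison[where V = V and \<phi> = \<phi> and \<phi>' = \<phi>' and \<phi>'' = \<phi>''
        and u' = u' and u'' = u'' and N = N])
    show "\<phi> (2 * pi) = \<phi> 0" "\<phi>' (2 * pi) = \<phi>' 0" "u (2 * pi) = u 0" "u' (2 * pi) = u' 0"
      using \<phi>_per \<open>periodic_2pi \<phi>'\<close> u_per periodic_vector_derivative[OF u_per u]
      by (auto intro: periodic_2pi_endpoints)
  qed (auto intro: has_field_derivative_at_within has_vector_derivative_at_within
      \<phi> \<phi>' \<phi>_pos u u''_int u' \<eta>_int N e simp: N_\<eta>)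
  have norm: "(L2_norm \<psi>)\<^sup>2 = integral {0..2 * pi} (\<lambda>x. (cmod (u x))\<^sup>2)"
    unfolding L2_norm_power2[OF \<psi>] by (rule integral_spike[OF N]) (simp add: N_\<psi>)
  \<comment> \<open>\<open>L2_inner\<close> is a Lebesgue integral, so passing to the gauge integral
    requires absolute integrability. It holds for continuous \<open>u\<close> times integrable
    \<open>\<eta>\<close> and carries over to \<open>\<psi>\<close> off \<open>N\<close>.\<close>
  have "continuous_on {0..2 * pi} u"
    by (rule continuous_on_vector_derivative[OF has_vector_derivative_at_within[OF u]])
  then have u\<eta>_int: "(\<lambda>x. cnj (u x) * \<eta> x) absolutely_integrable_on {0..2 * pi}"
    by (intro absolutely_integrable_continuous_mult continuous_on_cnj \<eta>_int)
  then have "(\<lambda>x. cnj (\<psi> x) * \<eta> x) absolutely_integrable_on {0..2 * pi}"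
    by (rule absolutely_integrable_spike[OF _ N]) (simp add: N_\<psi>)
  then have "L2_inner \<psi> \<eta> = integral {0..2 * pi} (\<lambda>x. cnj (\<psi> x) * \<eta> x)"
    unfolding L2_inner_def by (rule set_lebesgue_integral_eq_integral)
  also have "\<dots> = integral {0..2 * pi} (\<lambda>x. cnj (u x) * \<eta> x)"
    by (rule integral_spike[OF N]) (simp add: N_\<psi>)
  finally have "Re (L2_inner \<psi> \<eta>) = integral {0..2 * pi} (\<lambda>x. Re (cnj (u x) * \<eta> x))"
    using integral_linear[OF set_lebesgue_integral_eq_integral(1)[OF u\<eta>_int] bounded_linear_Re]
    by (simp add: o_def)
  then show ?thesis
    using bound norm by simp
qed

theorem lemma1:
  fixes V \<phi> :: "real \<Rightarrow> real"
  assumes V_periodic: "periodic_2pi V"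
    and H_self_adjoint: "self_adjoint (schroedinger V)"
    and H_bounded_below: "bounded_below (schroedinger V)"
    and phi_periodic: "periodic_2pi \<phi>"
    and phi_differentiable: "\<phi> differentiable_on UNIV"
    and phi_twice_differentiable: "deriv \<phi> differentiable_on UNIV"
    and phi_pos: "\<And>\<theta>. \<phi> \<theta> > 0"
    and min_exists: "\<exists>\<theta>\<^sub>0. \<forall>\<theta>. V \<theta>\<^sub>0 - deriv (deriv \<phi>) \<theta>\<^sub>0 / \<phi> \<theta>\<^sub>0 \<le> V \<theta> - deriv (deriv \<phi>) \<theta> / \<phi> \<theta>"
  shows "ground_state_energy (schroedinger V) \<ge>
    (LEAST e. e \<in> range (\<lambda>\<theta>. V \<theta> - deriv (deriv \<phi>) \<theta> / \<phi> \<theta>))"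
proof -
  define e where "e = (LEAST e. e \<in> range (\<lambda>\<theta>. V \<theta> - deriv (deriv \<phi>) \<theta> / \<phi> \<theta>))"
  obtain \<theta>\<^sub>0 where
    "\<And>\<theta>. V \<theta>\<^sub>0 - deriv (deriv \<phi>) \<theta>\<^sub>0 / \<phi> \<theta>\<^sub>0 \<le> V \<theta> - deriv (deriv \<phi>) \<theta> / \<phi> \<theta>"
    using min_exists by blast
  \<comment> \<open>\<open>LEAST\<close> denotes a definite value only because the minimum is
    attained.\<close>
  moreover from this have "e = V \<theta>\<^sub>0 - deriv (deriv \<phi>) \<theta>\<^sub>0 / \<phi> \<theta>\<^sub>0"
    unfolding e_def by (intro Least_equality) auto
  ultimately have e: "e \<le> V \<theta> - deriv (deriv \<phi>) \<theta> / \<phi> \<theta>" for \<theta>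
    by simp
  \<comment> \<open>\<open>deriv\<close> is a choice operator; differentiability makes its values
    genuine derivatives.\<close>
  have \<phi>: "(\<phi> has_real_derivative deriv \<phi> x) (at x)"
    "(deriv \<phi> has_real_derivative deriv (deriv \<phi>) x) (at x)" for x
    using phi_differentiable phi_twice_differentiable
    by (auto simp: differentiable_on_def real_differentiable_def dest: DERIV_imp_deriv)
  have "e \<le> Re (L2_inner \<psi> \<eta>)" if "(\<psi>, \<eta>) \<in> schroedinger V" "L2_norm \<psi> = 1" for \<psi> \<eta>
    using schroedinger_form_lower_bound[OF that(1) phi_periodic \<phi> phi_pos e] that(2) by simp
  moreover obtain \<psi> \<eta> where "(\<psi>, \<eta>) \<in> schroedinger V" "L2_norm \<psi> = 1"
    using self_adjoint_unit_vector[OF H_self_adjoint] .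
  ultimately show ?thesis
    unfolding ground_state_energy_def e_def[symmetric] by (intro cInf_greatest) auto
qed

end
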